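(* Let $k\geq 3$ be an integer and let $G$ be a $k$-regular bipartite graph with bipartition $(X,Y)$. Then $G$ contains a 1-anti-factor, i.e., a spanning subgraph $F$ of $G$ such that $d_F(x)=1$ for every $x\in X$ and $d_F(y)\neq 1$ for every $y\in Y$.
   Context: Graphs are finite, simple and undirected. $d_F(v)$ denotes the degree of $v$ in the subgraph $F$. *)

theory Defs
  imports "Graph_Theory.Graph_Theory"
begin

text \<open>
  A finite simple undirected graph is the library's \<^locale>\<open>graph\<close>: a finite loop-free digraph
  without parallel arcs whose arc relation is symmetric. Each undirected edge is thus a pair of
  opposite arcs, and each edge incident with \<open>v\<close> contributes exactly one arc leaving \<open>v\<close>, so the
  undirected degree is the out-degree. The library's \<^const>\<open>in_degree\<close> plus \<^const>\<open>out_degree\<close>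
  would count every edge twice.
\<close>

definition degree :: "('a, 'b) pre_digraph \<Rightarrow> 'a \<Rightarrow> nat" where
  "degree G v = out_degree G v"

definition regular_graph :: "nat \<Rightarrow> ('a, 'b) pre_digraph \<Rightarrow> bool" where
  "regular_graph k G \<longleftrightarrow> graph G \<and> (\<forall>v \<in> verts G. degree G v = k)"

definition bipartition :: "('a, 'b) pre_digraph \<Rightarrow> 'a set \<Rightarrow> 'a set \<Rightarrow> bool" where
  "bipartition G X Y \<longleftrightarrow>
     X \<union> Y = verts G \<and> X \<inter> Y = {} \<and>
     (\<forall>e \<in> arcs G. tail G e \<in> X \<and> head G e \<in> Y \<or> tail G e \<in> Y \<and> head G e \<in> X)"

text \<open>
  \<^const>\<open>spanning\<close> only makes \<open>F\<close> a spanning sub-digraph; the conjunct \<^prop>\<open>graph F\<close> forces \<open>F\<close>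
  to contain both arcs of an edge or neither, i.e. to be an undirected subgraph.
\<close>

definition spanning_subgraph :: "('a, 'b) pre_digraph \<Rightarrow> ('a, 'b) pre_digraph \<Rightarrow> bool" where
  "spanning_subgraph F G \<longleftrightarrow> graph F \<and> spanning F G"

definition one_anti_factor ::
  "('a, 'b) pre_digraph \<Rightarrow> ('a, 'b) pre_digraph \<Rightarrow> 'a set \<Rightarrow> 'a set \<Rightarrow> bool" where
  "one_anti_factor F G X Y \<longleftrightarrow>
     spanning_subgraph F G \<and> (\<forall>x \<in> X. degree F x = 1) \<and> (\<forall>y \<in> Y. degree F y \<noteq> 1)"

end

theory Submission
  imports Defs
begin

text \<open>
  By Hall's theorem \<open>G\<close> has a cubic spanning subgraph, so let \<open>k = 3\<close>. Join two vertices of \<open>X\<close> if they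
  have a common neighbour; it suffices to partition \<open>X\<close> into edges of this graph and full
  neighbourhoods of vertices of \<open>Y\<close>. Take a Gallai--Edmonds barrier \<open>S\<close> of \<open>X\<close>, whose parts \<open>C\<close> are
  factor-critical. The number of edges of \<open>G\<close> between \<open>S\<close> and the neighbours of \<open>C\<close> is \<open>3(|N(C)| - |C|)\<close>,
  a multiple of \<open>3\<close>. If it is at least \<open>3\<close> for every part that cannot be partitioned by itself, then Hall's
  condition holds and these parts can be matched into \<open>S\<close>.

  So the point is that a factor-critical \<open>K\<close> with at most three outgoing edges can be partitioned. Remove
  a neighbourhood \<open>T = {v, a, b}\<close> inside \<open>K\<close>. If the rest has no perfect matching, it has a barrier; adding \<open>T\<close>
  to it gives a set \<open>S\<close> with exactly \<open>|S| - 1\<close> parts, and counting edges shows that all but at most one of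
  them have three outgoing edges. A perfect matching of \<open>K - v\<close> sends \<open>a\<close> and \<open>b\<close> to different parts, so one of these
  two parts, \<open>C\<close> say, has three outgoing edges and can be partitioned by induction. Pairing \<open>v\<close> with the
  partner of \<open>C\<close> in \<open>T\<close> and keeping the matching elsewhere partitions \<open>K\<close>.
\<close>

subsection \<open>Hall's theorem and cubic spanning subgraphs\<close>

text \<open>Halmos-Vaughan induction on \<open>card A\<close>: either a proper nonempty subset is
  tight and the problem splits along it, or all of them have slack and an arbitrary edge may be
  used.\<close>

lemma hall:
  fixes R :: "('a \<times> 'b) set"
  assumes "finite A" "finite R" "\<And>B. B \<subseteq> A \<Longrightarrow> card B \<le> card (R `` B)"
  shows "\<exists>f. inj_on f A \<and> (\<forall>x\<in>A. (x, f x) \<in> R)"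
  using assms
proof (induction "card A" arbitrary: A R rule: less_induct)
  case less
  note fin = less.prems(1,2) and hall = less.prems(3)
  have fI: "finite (T `` B)" if "T \<subseteq> R" for T B
    using finite_Image[of T B] finite_subset[OF that] fin by blast
  consider "A = {}"
    | (tight) B where "B \<noteq> {}" "B \<subset> A" "card (R `` B) = card B"
    | (loose) "A \<noteq> {}" "\<And>B. B \<noteq> {} \<Longrightarrow> B \<subset> A \<Longrightarrow> card B < card (R `` B)"
    using hall by (metis le_neq_implies_less psubset_imp_subset)
  then show ?case
  proof cases
    case 1
    then show ?thesis by simp
  next
    case tight
    have finB: "finite B" using tight fin finite_subset by blast
    have "\<exists>f. inj_on f B \<and> (\<forall>x\<in>B. (x, f x) \<in> R)"
      using tight fin finB by (intro less.hyps) (auto intro!: hall psubset_card_mono)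
    then obtain f where f: "inj_on f B" "\<And>x. x \<in> B \<Longrightarrow> (x, f x) \<in> R" by auto
    \<comment> \<open>Once the neighbours of \<open>B\<close> are deleted, Hall's condition survives
      on \<open>A - B\<close>: subtracting the tight equality for \<open>B\<close> from the
      condition for \<open>B \<union> C\<close> leaves the one for \<open>C\<close>.\<close>
    let ?T = "R - UNIV \<times> R `` B"
    have "\<exists>g. inj_on g (A - B) \<and> (\<forall>x\<in>A - B. (x, g x) \<in> ?T)"
    proof (rule less.hyps)
      show "card (A - B) < card A" using tight fin by (intro psubset_card_mono) auto
      show "finite (A - B)" "finite ?T" using fin by auto
    next
      fix C assume C: "C \<subseteq> A - B"
      then have finC: "finite C" using fin finite_subset by blast
      have "card B + card C = card (B \<union> C)" using C finB finC by (subst card_Un_disjoint) auto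
      also have "\<dots> \<le> card (R `` (B \<union> C))" using C tight by (intro hall) auto
      also have "R `` (B \<union> C) = R `` B \<union> ?T `` C" by auto
      also have "card \<dots> \<le> card (R `` B) + card (?T `` C)" by (rule card_Un_le)
      finally show "card C \<le> card (?T `` C)" using tight by simp
    qed
    then obtain g where g: "inj_on g (A - B)" "\<And>x. x \<in> A - B \<Longrightarrow> (x, g x) \<in> ?T" by auto
    have "inj_on (\<lambda>x. if x \<in> B then f x else g x) A"
      using f g by (fastforce simp: inj_on_def)
    then show ?thesis using f(2) g(2)
      by (intro exI[of _ "\<lambda>x. if x \<in> B then f x else g x"]) auto
  next
    case loose
    then obtain x where x: "x \<in> A" by auto
    have "card {x} \<le> card (R `` {x})" using x by (intro hall) auto
    then have "R `` {x} \<noteq> {}" by auto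
    then obtain y where y: "(x, y) \<in> R" by auto
    \<comment> \<open>Deleting \<open>y\<close> costs a set at most one neighbour, which the strict
      inequality pays for.\<close>
    let ?T = "R - UNIV \<times> {y}"
    have "\<exists>g. inj_on g (A - {x}) \<and> (\<forall>x\<in>A - {x}. (x, g x) \<in> ?T)"
    proof (rule less.hyps)
      show "card (A - {x}) < card A" using x fin by (intro psubset_card_mono) auto
      show "finite (A - {x})" "finite ?T" using fin by auto
    next
      fix C assume C: "C \<subseteq> A - {x}"
      show "card C \<le> card (?T `` C)"
      proof (cases "C = {}")
        case False
        then have "card C < card (R `` C)" using C x by (intro loose) auto
        also have "\<dots> \<le> card (insert y (?T `` C))" using fI[of ?T C] by (intro card_mono) auto
        also have "\<dots> \<le> Suc (card (?T `` C))" by (rule card_insert_le_m1) auto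
        finally show ?thesis by simp
      qed simp
    qed
    then obtain g where g: "inj_on g (A - {x})" "\<And>z. z \<in> A - {x} \<Longrightarrow> (z, g z) \<in> ?T" by auto
    have "inj_on (g(x := y)) A" using g by (fastforce simp: inj_on_def)
    then show ?thesis using g(2) y
      by (intro exI[of _ "g(x := y)"]) auto
  qed
qed

text \<open>Applying Hall's theorem from the side of \<open>B\<close> after enlarging \<open>A\<close> by \<open>card B - card A\<close> dummies
  that are joined to \<open>B - W\<close> only gives a bijection.\<close>

lemma hall_two_sided:
  fixes R :: "('a \<times> 'b) set"
  assumes fin: "finite A" "finite B" and R: "R \<subseteq> A \<times> B" and W: "W \<subseteq> B"
    and hall_left: "\<And>C. C \<subseteq> A \<Longrightarrow> card C \<le> card (R `` C)"
    and hall_right: "\<And>D. D \<subseteq> W \<Longrightarrow> card D \<le> card (R\<inverse> `` D)"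
  shows "\<exists>f. inj_on f A \<and> (\<forall>x\<in>A. (x, f x) \<in> R) \<and> W \<subseteq> f ` A"
proof -
  have finR: "finite R" using finite_subset[OF R] fin by simp
  have "card A \<le> card (R `` A)" by (rule hall_left) simp
  also have "\<dots> \<le> card B" using R fin by (intro card_mono) auto
  finally have AB: "card A \<le> card B" .
  define n where "n = card B - card A"
  define T :: "('b \<times> ('a + nat)) set"
    where "T = (\<lambda>(x, y). (y, Inl x)) ` R \<union> (B - W) \<times> (Inr ` {..<n})"
  have T_im: "T `` D = Inl ` (R\<inverse> `` D) \<union> (if D \<subseteq> W then {} else Inr ` {..<n})" if "D \<subseteq> B" for D
    using that unfolding T_def by (auto simp: image_iff split: if_splits)
  have card_T_im: "card (T `` D) = card (R\<inverse> `` D) + (if D \<subseteq> W then 0 else n)" if "D \<subseteq> B" for D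
  proof -
    have "finite (R\<inverse> `` D)" using finR by (simp add: finite_Image)
    then have "card (Inl ` (R\<inverse> `` D) \<union> Inr ` {..<n}) = card (R\<inverse> `` D) + n"
      by (subst card_Un_disjoint) (auto simp: card_image)
    then show ?thesis using T_im[OF that] by (auto simp: card_image)
  qed
  have "\<exists>g. inj_on g B \<and> (\<forall>y\<in>B. (y, g y) \<in> T)"
  proof (rule hall)
    show "finite B" "finite T" unfolding T_def using fin finR by auto
  next
    fix D assume D: "D \<subseteq> B"
    show "card D \<le> card (T `` D)"
    proof (cases "D \<subseteq> W")
      case True
      then show ?thesis using hall_right[OF True] D by (simp add: card_T_im)
    next
      case False
      \<comment> \<open>A set \<open>D\<close> not inside \<open>W\<close> sees all \<open>n\<close>
        dummies. Vertices of \<open>A\<close> without a neighbour in \<open>D\<close> have all their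
        neighbours in \<open>B - D\<close>, and Hall's condition for them gives the bound
        needed.\<close>
      let ?C = "A - R\<inverse> `` D"
      have "card ?C \<le> card (R `` ?C)" by (rule hall_left) simp
      also have "\<dots> \<le> card (B - D)" using fin R by (intro card_mono) auto
      also have "\<dots> = card B - card D" using D fin finite_subset by (intro card_Diff_subset) auto
      finally have 1: "card ?C \<le> card B - card D" .
      have "R\<inverse> `` D \<subseteq> A" using R by auto
      then have 2: "card ?C = card A - card (R\<inverse> `` D)" "card (R\<inverse> `` D) \<le> card A"
        using fin finite_subset by (auto intro!: card_Diff_subset card_mono)
      have "card D \<le> card B" using D fin by (simp add: card_mono)
      then show ?thesis using 1 2 AB False D by (simp add: card_T_im n_def)
    qed
  qed
  then obtain g where g: "inj_on g B" "\<And>y. y \<in> B \<Longrightarrow> (y, g y) \<in> T" by auto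
  have "g ` B \<subseteq> T `` B" using g by auto
  also have "\<dots> \<subseteq> Inl ` A \<union> Inr ` {..<n}" unfolding T_def using R by auto
  finally have sub: "g ` B \<subseteq> Inl ` A \<union> Inr ` {..<n}" .
  \<comment> \<open>Equal sizes make \<open>g\<close> a bijection, so it can be inverted on the
    \<open>Inl\<close> copies. No dummy is joined to \<open>W\<close>, so the inverse hits all of
    \<open>W\<close>.\<close>
  have "card (Inl ` A \<union> Inr ` {..<n}) = card A + n"
    using fin by (subst card_Un_disjoint) (auto simp: card_image)
  also have "\<dots> = card (g ` B)" using AB g by (simp add: n_def card_image)
  finally have img: "g ` B = Inl ` A \<union> Inr ` {..<n}"
    using sub fin by (intro card_subset_eq) auto
  define f where "f x = inv_into B g (Inl x)" for x
  have f: "f x \<in> B" "g (f x) = Inl x" if "x \<in> A" for x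
    using that img unfolding f_def by (auto simp: inv_into_into f_inv_into_f)
  have "inj_on f A" by (rule inj_onI) (metis f(2) sum.inject(1))
  moreover have "(x, f x) \<in> R" if "x \<in> A" for x
    using g(2)[OF f(1)[OF that]] f(2)[OF that] unfolding T_def by auto
  moreover have "y \<in> f ` A" if y: "y \<in> W" for y
  proof -
    have yB: "y \<in> B" using y W by auto
    then obtain x where "g y = Inl x" "x \<in> A" using g(2)[OF yB] y R unfolding T_def by auto
    then show ?thesis using f[of x] g(1) yB by (metis image_eqI inj_onD)
  qed
  ultimately show ?thesis by blast
qed

section \<open>Regular bipartite graphs as relations\<close>

locale regular_bipartite =
  fixes k :: nat and X :: "'a set" and Y :: "'b set" and R :: "('a \<times> 'b) set"
  assumes finite_X: "finite X" and finite_Y: "finite Y"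
    and R_sub: "R \<subseteq> X \<times> Y"
    and card_nbs: "x \<in> X \<Longrightarrow> card (R `` {x}) = k"
    and card_nbs': "y \<in> Y \<Longrightarrow> card (R\<inverse> `` {y}) = k"
begin

lemma finite_R: "finite R"
  using finite_subset[OF R_sub] finite_X finite_Y by simp

lemma converse: "regular_bipartite k Y X (R\<inverse>)"
  using finite_X finite_Y R_sub card_nbs card_nbs' by unfold_locales auto

lemma card_edges:
  assumes "A \<subseteq> X"
  shows "card (SIGMA x:A. R `` {x}) = k * card A"
proof -
  have "finite A" using assms finite_X finite_subset by blast
  then have "card (SIGMA x:A. R `` {x}) = (\<Sum>x\<in>A. card (R `` {x}))"
    using finite_R by (simp add: finite_Image)
  also have "\<dots> = (\<Sum>x\<in>A. k)" using assms card_nbs by (intro sum.cong) auto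
  finally show ?thesis by simp
qed

end

text \<open>All \<open>k * card A\<close> edges at \<open>A\<close> end among its neighbours, each
  of which carries only \<open>k\<close> edges.\<close>

lemma (in regular_bipartite) expansion:
  assumes "A \<subseteq> X" "k > 0"
  shows "card A \<le> card (R `` A)"
proof -
  interpret c: regular_bipartite k Y X "R\<inverse>" by (rule converse)
  have sub: "R `` A \<subseteq> Y" using R_sub by auto
  have fin: "finite (SIGMA y:R `` A. R\<inverse> `` {y})"
    using finite_R by (intro finite_SigmaI) (auto intro: finite_Image)
  have "k * card A = card (prod.swap ` (SIGMA x:A. R `` {x}))"
    using card_edges[OF assms(1)] by (simp add: card_image)
  also have "\<dots> \<le> card (SIGMA y:R `` A. R\<inverse> `` {y})"
    by (rule card_mono[OF fin]) auto
  also have "\<dots> = k * card (R `` A)" using c.card_edges[OF sub] .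
  finally show ?thesis using assms(2) by simp
qed

text \<open>Hall's theorem gives a perfect matching; deleting it lowers every degree by one, and
  this is repeated down to degree 3.\<close>

lemma regular_bipartite_3:
  assumes "k \<ge> 3" "regular_bipartite k X Y R"
  shows "\<exists>T\<subseteq>R. regular_bipartite 3 X Y T"
  using assms
proof (induction k arbitrary: R rule: dec_induct)
  case base
  then show ?case by auto
next
  case (step k)
  interpret regular_bipartite "Suc k" X Y R by fact
  interpret c: regular_bipartite "Suc k" Y X "R\<inverse>" by (rule converse)
  obtain f where f: "inj_on f X" "\<And>x. x \<in> X \<Longrightarrow> (x, f x) \<in> R"
    using hall[OF finite_X finite_R] expansion by (metis zero_less_Suc)
  have "R `` X \<subseteq> Y" "R\<inverse> `` Y \<subseteq> X" using R_sub by auto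
  \<comment> \<open>Expansion from both sides forces equal sizes, so the injection \<open>f\<close>
    is onto \<open>Y\<close> and its removal lowers the degrees in \<open>Y\<close> as well.\<close>
  then have "card X = card Y"
    using expansion[of X] c.expansion[of Y] card_mono[OF finite_Y] card_mono[OF finite_X]
    by (metis le_antisym le_trans subset_refl zero_less_Suc)
  moreover have "f ` X \<subseteq> Y" using f R_sub by auto
  ultimately have fX: "f ` X = Y"
    using f by (intro card_subset_eq finite_Y) (auto simp: card_image)
  let ?T = "R - (\<lambda>x. (x, f x)) ` X"
  have "regular_bipartite k X Y ?T"
  proof
    show "finite X" "finite Y" "?T \<subseteq> X \<times> Y" using finite_X finite_Y R_sub by auto
  next
    fix x assume x: "x \<in> X"
    then have "?T `` {x} = R `` {x} - {f x}" by auto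
    then show "card (?T `` {x}) = k" using card_nbs[OF x] f(2)[OF x] by simp
  next
    fix y assume y: "y \<in> Y"
    then obtain x where x: "x \<in> X" "y = f x" using fX by auto
    then have "?T\<inverse> `` {y} = R\<inverse> `` {y} - {x}" using f R_sub by (auto dest: inj_onD)
    then show "card (?T\<inverse> `` {y}) = k" using card_nbs'[OF y] f(2)[OF x(1)] x by simp
  qed
  then obtain T where "T \<subseteq> ?T" "regular_bipartite 3 X Y T" using step.IH[of ?T] by auto
  then show ?case by (intro exI[of _ T]) auto
qed

subsection \<open>Barriers\<close>

text \<open>A perfect matching is encoded as a fixed-point-free involution. The condition
  \<open>m x \<noteq> x\<close> matters because the relation used later is reflexive on
  \<open>X\<close>.\<close>

definition matchable :: "('a \<times> 'a) set \<Rightarrow> 'a set \<Rightarrow> bool" where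
  "matchable E V \<longleftrightarrow> (\<exists>m. \<forall>x\<in>V. m x \<in> V \<and> m x \<noteq> x \<and> m (m x) = x \<and> (x, m x) \<in> E)"

lemma matchable_empty [simp]: "matchable E {}"
  by (simp add: matchable_def)

lemma matchable_Un:
  assumes "matchable E A" "matchable E B" "A \<inter> B = {}"
  shows "matchable E (A \<union> B)"
proof -
  obtain m where m: "\<forall>x\<in>A. m x \<in> A \<and> m x \<noteq> x \<and> m (m x) = x \<and> (x, m x) \<in> E"
    using assms(1) unfolding matchable_def by blast
  obtain n where n: "\<forall>x\<in>B. n x \<in> B \<and> n x \<noteq> x \<and> n (n x) = x \<and> (x, n x) \<in> E"
    using assms(2) unfolding matchable_def by blast
  have "x \<notin> B" if "x \<in> A" for x using assms(3) that by auto
  then show ?thesis unfolding matchable_def using m n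
    by (intro exI[of _ "\<lambda>x. if x \<in> A then m x else n x"]) auto
qed

lemma matchable_pair:
  assumes "sym E" "(a, b) \<in> E" "a \<noteq> b"
  shows "matchable E {a, b}"
  unfolding matchable_def using assms
  by (intro exI[of _ "\<lambda>x. if x = a then b else a"]) (simp add: symD)

lemma matchable_even:
  assumes "finite V" "matchable E V"
  shows "even (card V)"
  using assms
proof (induction "card V" arbitrary: V rule: less_induct)
  case less
  obtain m where m: "\<And>x. x \<in> V \<Longrightarrow> m x \<in> V \<and> m x \<noteq> x \<and> m (m x) = x \<and> (x, m x) \<in> E"
    using less.prems(2) unfolding matchable_def by blast
  show ?case
  proof (cases "V = {}")
    case False
    then obtain x where x: "x \<in> V" by auto
    let ?W = "V - {x, m x}"
    have "matchable E ?W"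
      unfolding matchable_def
    proof (intro exI[of _ m] ballI)
      fix z assume z: "z \<in> ?W"
      then have "m z \<noteq> x" "m z \<noteq> m x" using m[of z] m[OF x] by auto
      then show "m z \<in> ?W \<and> m z \<noteq> z \<and> m (m z) = z \<and> (z, m z) \<in> E" using m[of z] z by auto
    qed
    moreover have "card V = card ?W + 2"
    proof -
      have "card {x, m x} = 2" using m[OF x] by auto
      moreover have "{x, m x} \<subseteq> V" using m[OF x] x by auto
      ultimately show ?thesis using less.prems(1) card_Diff_subset[of "{x, m x}" V] card_mono[of V "{x, m x}"]
        by auto
    qed
    ultimately show ?thesis using less.hyps[of ?W] less.prems(1) by auto
  qed simp
qed

text \<open>Stated for an arbitrary property because it serves both \<open>matchable\<close> and
  \<open>anti_factorable\<close> sets.\<close>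

lemma disjoint_family_Union:
  assumes empty: "P {}"
    and union: "\<And>A B. P A \<Longrightarrow> P B \<Longrightarrow> A \<inter> B = {} \<Longrightarrow> P (A \<union> B)"
    and "finite I" "\<And>i. i \<in> I \<Longrightarrow> P (F i)"
    and "\<And>i j. i \<in> I \<Longrightarrow> j \<in> I \<Longrightarrow> i \<noteq> j \<Longrightarrow> F i \<inter> F j = {}"
  shows "P (\<Union>i\<in>I. F i)"
  using assms(3-5)
proof (induction I rule: finite_induct)
  case (insert i I)
  have "F i \<inter> F j = {}" if "j \<in> I" for j
    using insert.hyps(2) that insert.prems(2)[of i j] by auto
  then have "F i \<inter> (\<Union>j\<in>I. F j) = {}" by auto
  then show ?case using insert union by simp
qed (simp add: empty)

definition critical :: "('a \<times> 'a) set \<Rightarrow> 'a set \<Rightarrow> bool" where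
  "critical E C \<longleftrightarrow> C \<noteq> {} \<and> (\<forall>c\<in>C. matchable E (C - {c}))"

lemma critical_odd:
  assumes "finite C" "critical E C"
  shows "odd (card C)"
proof -
  obtain c where c: "c \<in> C" "matchable E (C - {c})" using assms unfolding critical_def by auto
  then have "even (card (C - {c}))" using assms by (intro matchable_even) auto
  then show ?thesis using c assms card_Suc_Diff1[of C c] by (metis even_Suc)
qed

text \<open>Coarsenings of the partition into connected components: using them instead of the components
  themselves makes connectivity unnecessary.\<close>

definition separated_partition :: "('a \<times> 'a) set \<Rightarrow> 'a set \<Rightarrow> 'a set set \<Rightarrow> bool" where
  "separated_partition E V P \<longleftrightarrow> \<Union>P = V \<and> {} \<notin> P \<and>
     (\<forall>C\<in>P. \<forall>D\<in>P. C \<noteq> D \<longrightarrow> C \<inter> D = {} \<and> E \<inter> C \<times> D = {})"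

lemma separated_partitionI:
  assumes "\<Union>P = V" "{} \<notin> P"
    and "\<And>C D. C \<in> P \<Longrightarrow> D \<in> P \<Longrightarrow> C \<noteq> D \<Longrightarrow> C \<inter> D = {} \<and> E \<inter> C \<times> D = {}"
  shows "separated_partition E V P"
  using assms unfolding separated_partition_def by simp

text \<open>The bipartite graph that arises by contracting every part to one vertex. Here
  \<open>s\<close> is arbitrary; the uses below restrict it to the barrier.\<close>

definition attached :: "('a \<times> 'a) set \<Rightarrow> 'a set set \<Rightarrow> ('a \<times> 'a set) set" where
  "attached E P = {(s, C). C \<in> P \<and> (\<exists>c\<in>C. (s, c) \<in> E)}"

text \<open>The last conjunct is Hall's condition for matching \<open>S\<close> into the parts. In
  this form \<open>barrier_cover\<close> can combine it with a condition from the other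
  side.\<close>

definition barrier :: "('a \<times> 'a) set \<Rightarrow> 'a set \<Rightarrow> 'a set \<Rightarrow> 'a set set \<Rightarrow> bool" where
  "barrier E V S P \<longleftrightarrow> S \<subseteq> V \<and> separated_partition E (V - S) P \<and> (\<forall>C\<in>P. critical E C) \<and>
     (\<forall>B\<subseteq>S. card B \<le> card (attached E P `` B))"

lemma separated_partition_finite:
  assumes "finite V" "separated_partition E V P"
  shows "finite P" "C \<in> P \<Longrightarrow> finite C" "C \<in> P \<Longrightarrow> C \<subseteq> V"
proof -
  show *: "C \<subseteq> V" if "C \<in> P" for C using that assms unfolding separated_partition_def by auto
  then show "finite C" if "C \<in> P" using that assms finite_subset by blast
  show "finite P" using * assms(1) by (meson Pow_iff finite_Pow_iff finite_subset subsetI)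
qed

lemma separated_partition_card:
  assumes "finite V" "separated_partition E V P"
  shows "card V = (\<Sum>C\<in>P. card C)"
proof -
  note f = separated_partition_finite[OF assms]
  have "card (\<Union>P) = (\<Sum>C\<in>P. card C)"
    using f assms(2) unfolding separated_partition_def
    by (intro card_Union_disjoint) (auto simp: pairwise_def disjnt_def)
  then show ?thesis using assms unfolding separated_partition_def by simp
qed

lemma attached_matchable:
  assumes "sym E" "critical E C" "(s, C) \<in> attached E P" "s \<notin> C"
  shows "matchable E (insert s C)"
proof -
  obtain c where c: "c \<in> C" "(s, c) \<in> E" using assms(3) unfolding attached_def by auto
  have "matchable E ({s, c} \<union> (C - {c}))"
    using assms c unfolding critical_def by (intro matchable_Un matchable_pair) auto
  moreover have "{s, c} \<union> (C - {c}) = insert s C" using c by auto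
  ultimately show ?thesis by simp
qed

lemma separated_partition_parity:
  assumes "finite V" "separated_partition E V P" "\<And>C. C \<in> P \<Longrightarrow> odd (card C)"
  shows "even (card V) \<longleftrightarrow> even (card P)"
proof -
  have "{C \<in> P. odd (card C)} = P" using assms(3) by auto
  then show ?thesis
    using separated_partition_card[OF assms(1,2)] even_sum_iff[of P card]
      separated_partition_finite(1)[OF assms(1,2)] by simp
qed

lemma barrier_parts:
  assumes "finite V" "barrier E V S P"
  shows "finite P" "C \<in> P \<Longrightarrow> finite C" "C \<in> P \<Longrightarrow> C \<subseteq> V - S" "C \<in> P \<Longrightarrow> odd (card C)"
proof -
  have "finite (V - S)" "separated_partition E (V - S) P"
    using assms unfolding barrier_def by auto
  note f = separated_partition_finite[OF this]
  show "finite P" "C \<in> P \<Longrightarrow> finite C" "C \<in> P \<Longrightarrow> C \<subseteq> V - S" by (fact f)+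
  show "odd (card C)" if "C \<in> P"
    using that f assms unfolding barrier_def by (intro critical_odd) auto
qed

lemma barrier_parity:
  assumes "finite V" "barrier E V S P"
  shows "even (card V) \<longleftrightarrow> even (card S + card P)"
proof -
  have S: "S \<subseteq> V" "separated_partition E (V - S) P" using assms unfolding barrier_def by auto
  then have "even (card (V - S)) \<longleftrightarrow> even (card P)"
    using assms(1) barrier_parts(4)[OF assms] by (intro separated_partition_parity) auto
  moreover have "card (V - S) + card S = card V"
    using S assms(1) by (metis card_Diff_subset card_mono finite_subset le_add_diff_inverse2)
  ultimately show ?thesis by (metis even_add)
qed

lemma finite_attached:
  assumes "finite P"
  shows "finite (attached E P `` B)" "attached E P `` B \<subseteq> P"
proof -
  show *: "attached E P `` B \<subseteq> P" unfolding attached_def by auto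
  show "finite (attached E P `` B)" using finite_subset[OF * assms] .
qed

text \<open>The set \<open>W\<close> collects the parts that have to be absorbed.
  \<open>hall_two_sided\<close> assigns distinct parts to the vertices of \<open>S\<close> so that
  \<open>W\<close> is used up, and each vertex has a perfect matching together with its critical
  part.\<close>

lemma barrier_cover:
  assumes "finite V" "sym E" "barrier E V S P" "W \<subseteq> P"
    and "\<And>D. D \<subseteq> W \<Longrightarrow> card D \<le> card {s \<in> S. \<exists>C\<in>D. (s, C) \<in> attached E P}"
  shows "\<exists>h. inj_on h S \<and> h ` S \<subseteq> P \<and> W \<subseteq> h ` S \<and> matchable E (\<Union>s\<in>S. insert s (h s))"
proof -
  note parts = barrier_parts[OF assms(1,3)]
  have S: "S \<subseteq> V" and sep: "separated_partition E (V - S) P"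
    and crit: "\<And>C. C \<in> P \<Longrightarrow> critical E C"
    and hall: "\<And>B. B \<subseteq> S \<Longrightarrow> card B \<le> card (attached E P `` B)"
    using assms(3) unfolding barrier_def by auto
  let ?R = "attached E P \<inter> S \<times> P"
  have "\<exists>h. inj_on h S \<and> (\<forall>s\<in>S. (s, h s) \<in> ?R) \<and> W \<subseteq> h ` S"
  proof (rule hall_two_sided)
    show "finite S" "finite P" using finite_subset[OF S assms(1)] parts(1) by auto
    show "?R \<subseteq> S \<times> P" "W \<subseteq> P" using assms(4) by auto
  next
    fix B assume "B \<subseteq> S"
    moreover from this have "?R `` B = attached E P `` B" by (auto simp: attached_def)
    ultimately show "card B \<le> card (?R `` B)" using hall by simp
  next
    fix D assume D: "D \<subseteq> W"
    then have "?R\<inverse> `` D = {s \<in> S. \<exists>C\<in>D. (s, C) \<in> attached E P}" using assms(4) by auto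
    then show "card D \<le> card (?R\<inverse> `` D)" using assms(5)[OF D] by simp
  qed
  then obtain h where h: "inj_on h S" "\<And>s. s \<in> S \<Longrightarrow> (s, h s) \<in> ?R" "W \<subseteq> h ` S" by auto
  have hP: "h s \<in> P" if "s \<in> S" for s using h(2)[OF that] by auto
  have "matchable E (\<Union>s\<in>S. insert s (h s))"
  proof (rule disjoint_family_Union[where P = "matchable E"])
    show "finite S" using finite_subset[OF S assms(1)] .
  next
    fix s assume s: "s \<in> S"
    then have "s \<notin> h s" using hP[OF s] parts(3) by auto
    then show "matchable E (insert s (h s))"
      using attached_matchable[OF assms(2) crit[OF hP[OF s]]] h(2)[OF s] by auto
  next
    fix s t assume st: "s \<in> S" "t \<in> S" "s \<noteq> t"
    have "h s \<noteq> h t" using h(1) st by (auto dest: inj_onD)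
    then have "h s \<inter> h t = {}" using sep hP st unfolding separated_partition_def by auto
    moreover have "s \<notin> h t" "t \<notin> h s" using st hP parts(3) by auto
    ultimately show "insert s (h s) \<inter> insert t (h t) = {}" using st by auto
  qed (auto intro: matchable_Un)
  moreover have "h ` S \<subseteq> P" using hP by auto
  ultimately show ?thesis using h by blast
qed

text \<open>If \<open>card P\<close> were \<open>card S\<close>, then \<open>barrier_cover\<close>
  would use all parts and match \<open>V\<close>. Parity raises the remaining gap from one to
  two.\<close>

lemma barrier_deficiency:
  assumes "finite V" "sym E" "barrier E V S P" "even (card V)" "\<not> matchable E V"
  shows "card S + 2 \<le> card P"
proof -
  note parts = barrier_parts[OF assms(1,3)]
  have S: "S \<subseteq> V" "\<Union>P = V - S" and "card S \<le> card (attached E P `` S)"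
    using assms(3) unfolding barrier_def separated_partition_def by auto
  then have le: "card S \<le> card P"
    using card_mono[OF parts(1) finite_attached(2)[OF parts(1)]] le_trans by blast
  obtain h where h: "inj_on h S" "h ` S \<subseteq> P" "matchable E (\<Union>s\<in>S. insert s (h s))"
    using barrier_cover[OF assms(1-3), of "{}"] by auto
  have "card P \<noteq> card S"
  proof
    assume "card P = card S"
    then have "h ` S = P" using h parts(1) by (intro card_subset_eq) (auto simp: card_image)
    then have "(\<Union>s\<in>S. insert s (h s)) = S \<union> \<Union>P" by auto
    then show False using h(3) S assms(5) by (simp add: Un_absorb1)
  qed
  moreover have "even (card S + card P)" using barrier_parity[OF assms(1,3)] assms(4) by simp
  ultimately show ?thesis using le by presburger
qed

text \<open>For moving the vertices of \<open>C - D\<close> into the barrier while the rest of the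
  part breaks up into \<open>Q\<close>.\<close>

lemma separated_partition_refine:
  assumes "separated_partition E V P" "C \<in> P" "separated_partition E D Q" "D \<subseteq> C"
  shows "separated_partition E ((V - C) \<union> D) ((P - {C}) \<union> Q)"
proof -
  have Q: "B \<subseteq> C" if "B \<in> Q" for B using that assms(3,4) unfolding separated_partition_def by auto
  have dj: "A \<inter> B = {} \<and> E \<inter> A \<times> B = {} \<and> E \<inter> B \<times> A = {}" if "A \<in> P - {C}" "B \<in> Q" for A B
  proof -
    have "A \<inter> C = {}" "E \<inter> A \<times> C = {}" "E \<inter> C \<times> A = {}"
      using that(1) assms(1,2) unfolding separated_partition_def by auto
    then show ?thesis using Q[OF that(2)] by blast
  qed
  have "\<Union>(P - {C}) = V - C" using assms(1,2) unfolding separated_partition_def by auto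
  moreover have "\<Union>Q = D" using assms(3) unfolding separated_partition_def by auto
  ultimately have "\<Union>((P - {C}) \<union> Q) = (V - C) \<union> D" by auto
  moreover have "{} \<notin> (P - {C}) \<union> Q" using assms(1,3) unfolding separated_partition_def by auto
  moreover have "A \<inter> B = {} \<and> E \<inter> A \<times> B = {}"
    if AB: "A \<in> (P - {C}) \<union> Q" "B \<in> (P - {C}) \<union> Q" "A \<noteq> B" for A B
  proof -
    consider "A \<in> P" "B \<in> P" | "A \<in> Q" "B \<in> Q" | "A \<in> P - {C}" "B \<in> Q" | "A \<in> Q" "B \<in> P - {C}"
      using AB by auto
    then show ?thesis
    proof cases
      case 1
      then show ?thesis using assms(1) AB(3) unfolding separated_partition_def by simp
    next
      case 2
      then show ?thesis using assms(3) AB(3) unfolding separated_partition_def by simp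
    next
      case 3
      then show ?thesis using dj by simp
    next
      case 4
      then show ?thesis using dj[of B A] by (simp add: Int_commute)
    qed
  qed
  ultimately show ?thesis by (rule separated_partitionI)
qed

text \<open>The opposite move: the vertices of \<open>B\<close> leave the barrier and fuse with
  \<open>Q\<close>, which contains every part they touch.\<close>

lemma separated_partition_merge:
  assumes "separated_partition E V P" "Q \<subseteq> P" "B \<noteq> {}" "B \<inter> V = {}"
    and "\<And>b C. b \<in> B \<Longrightarrow> C \<in> P - Q \<Longrightarrow> E \<inter> {b} \<times> C = {} \<and> E \<inter> C \<times> {b} = {}"
  shows "separated_partition E (V \<union> B) (insert (B \<union> \<Union>Q) (P - Q))"
proof -
  have dj: "A \<inter> (B \<union> \<Union>Q) = {} \<and> E \<inter> A \<times> (B \<union> \<Union>Q) = {} \<and> E \<inter> (B \<union> \<Union>Q) \<times> A = {}" if A: "A \<in> P - Q" for A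
  proof -
    have "A \<inter> C = {} \<and> E \<inter> A \<times> C = {} \<and> E \<inter> C \<times> A = {}" if "C \<in> Q" for C
      using A that assms(1,2) unfolding separated_partition_def by (metis Diff_iff subsetD)
    moreover have "A \<inter> B = {}" using A assms(1,4) unfolding separated_partition_def by auto
    moreover have "E \<inter> {b} \<times> A = {} \<and> E \<inter> A \<times> {b} = {}" if "b \<in> B" for b using assms(5)[OF that A] .
    ultimately show ?thesis by blast
  qed
  have "\<Union>(insert (B \<union> \<Union>Q) (P - Q)) = V \<union> B" using assms(1,2) unfolding separated_partition_def by auto
  moreover have "{} \<notin> insert (B \<union> \<Union>Q) (P - Q)" using assms(1,3) unfolding separated_partition_def by auto
  moreover have "A \<inter> A' = {} \<and> E \<inter> A \<times> A' = {}"
    if "A \<in> insert (B \<union> \<Union>Q) (P - Q)" "A' \<in> insert (B \<union> \<Union>Q) (P - Q)" "A \<noteq> A'" for A A'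
  proof (cases "A = B \<union> \<Union>Q \<or> A' = B \<union> \<Union>Q")
    case True
    then show ?thesis using that dj[of A] dj[of A'] by blast
  next
    case False
    then show ?thesis using that assms(1) unfolding separated_partition_def by blast
  qed
  ultimately show ?thesis by (rule separated_partitionI)
qed

text \<open>The Gallai--Edmonds-type barrier of Diestel's \<open>Graph Theory\<close>, Theorem 2.2.3: among all pairs
  \<open>(S, P)\<close> maximise the number of odd parts minus \<open>card S\<close>, and then \<open>card S\<close>. The weight below encodes
  this lexicographic order.\<close>

lemma barrier_exists:
  assumes "finite V" "sym E"
  shows "\<exists>S P. barrier E V S P"
  using assms(1)
proof (induction "card V" arbitrary: V rule: less_induct)
  case less
  note fin = \<open>finite V\<close>
  define n where "n = int (card V)"
  define odds where "odds P = int (card {C \<in> P. odd (card C)})" for P :: "'a set set"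
  define valid where "valid = {(S, P). S \<subseteq> V \<and> separated_partition E (V - S) P}"
  define wt where "wt = (\<lambda>(S :: 'a set, P). (n + 1) * (odds P - int (card S)) + int (card S))"
  have "valid \<subseteq> Pow V \<times> Pow (Pow V)"
    unfolding valid_def separated_partition_def by auto
  then have finv: "finite valid" using fin by (simp add: finite_subset)
  have "(V, {}) \<in> valid" unfolding valid_def separated_partition_def by auto
  then have "Max (wt ` valid) \<in> wt ` valid" using finv by (intro Max_in) auto
  then obtain S P where SP: "(S, P) \<in> valid" and Max: "wt (S, P) = Max (wt ` valid)" by auto
  have wt_max: "wt q \<le> wt (S, P)" if "q \<in> valid" for q
    unfolding Max using finv that by (intro Max_ge) auto
  have S: "S \<subseteq> V" and sep: "separated_partition E (V - S) P" using SP unfolding valid_def by auto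
  have finS: "finite S" using S fin finite_subset by blast
  have cardS: "int (card T) \<le> n" if "T \<subseteq> V" for T
    using card_mono[OF fin that] by (simp add: n_def)
  \<comment> \<open>The factor \<open>n + 1\<close> exceeds every \<open>card S\<close>, so a gain
    of one in the difference outweighs any loss in size.\<close>
  have deficit_le: "odds Q - int (card T) \<le> odds P - int (card S)"
    if "T \<subseteq> V" "separated_partition E (V - T) Q" for T Q
  proof (rule ccontr)
    assume "\<not> ?thesis"
    then have "(n + 1) * (odds P - int (card S) + 1) \<le> (n + 1) * (odds Q - int (card T))"
      using cardS[OF S] by (intro mult_left_mono) auto
    moreover have "wt (T, Q) \<le> wt (S, P)" using that by (intro wt_max) (simp add: valid_def)
    ultimately show False using cardS[OF S] by (simp add: wt_def algebra_simps)
  qed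
  have no_larger: "odds Q - int (card T) < odds P - int (card S)"
    if "T \<subseteq> V" "separated_partition E (V - T) Q" "card S < card T" for T Q
  proof (rule ccontr)
    assume "\<not> ?thesis"
    then have "odds Q - int (card T) = odds P - int (card S)" using deficit_le[OF that(1,2)] by simp
    then have "wt (S, P) < wt (T, Q)" using that(3) by (simp add: wt_def)
    moreover have "wt (T, Q) \<le> wt (S, P)" using that by (intro wt_max) (simp add: valid_def)
    ultimately show False by simp
  qed
  note parts = separated_partition_finite[OF finite_Diff[OF fin] sep]
  have odds_le: "odds Q \<le> int (card Q)" if "finite Q" for Q
    unfolding odds_def using that by (simp add: card_mono)
  have ne: "C \<noteq> {}" if "C \<in> P" for C using that sep unfolding separated_partition_def by auto
  text \<open>Moving a vertex \<open>c\<close> together with a barrier \<open>T\<close> of \<open>C - {c}\<close> into \<open>S\<close>.\<close>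
  have refine: "separated_partition E (V - insert c (T \<union> S)) ((P - {C}) \<union> Q)
      \<and> card (insert c (T \<union> S)) = card S + card T + 1 \<and> insert c (T \<union> S) \<subseteq> V
      \<and> odds ((P - {C}) \<union> Q) = odds (P - {C}) + odds Q"
    if C: "C \<in> P" "c \<in> C" "T \<subseteq> C - {c}" "separated_partition E (C - {c} - T) Q" for C c T Q
  proof (intro conjI)
    have CV: "C \<subseteq> V - S" using parts(3) C by auto
    have "separated_partition E (V - S - C \<union> (C - {c} - T)) ((P - {C}) \<union> Q)"
      using C by (intro separated_partition_refine[OF sep]) auto
    moreover have "V - S - C \<union> (C - {c} - T) = V - insert c (T \<union> S)" using CV C(2,3) by auto
    ultimately show "separated_partition E (V - insert c (T \<union> S)) ((P - {C}) \<union> Q)" by simp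
    have finT: "finite T" using C(1,3) parts(2) finite_subset by blast
    have "c \<notin> T \<union> S" "T \<inter> S = {}" using C CV by auto
    then show "card (insert c (T \<union> S)) = card S + card T + 1"
      using finS finT by (simp add: card_Un_disjoint)
    show "insert c (T \<union> S) \<subseteq> V" using CV C S by auto
    have finC: "finite (C - {c} - T)" using parts(2)[OF C(1)] by auto
    have "A \<noteq> B" if "A \<in> P - {C}" "B \<in> Q" for A B
    proof -
      have "A \<inter> C = {}" using that(1) sep C(1) unfolding separated_partition_def by auto
      moreover have "B \<subseteq> C" "B \<noteq> {}" using that(2) C(4) unfolding separated_partition_def by auto
      ultimately show ?thesis by auto
    qed
    then have "{A \<in> P - {C}. odd (card A)} \<inter> {A \<in> Q. odd (card A)} = {}" by auto
    moreover have "{A \<in> P - {C} \<union> Q. odd (card A)}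
        = {A \<in> P - {C}. odd (card A)} \<union> {A \<in> Q. odd (card A)}" by auto
    ultimately show "odds ((P - {C}) \<union> Q) = odds (P - {C}) + odds Q"
      unfolding odds_def using parts(1) separated_partition_finite(1)[OF finC C(4)]
      by (simp add: card_Un_disjoint)
  qed
  \<comment> \<open>Moving one vertex of an even part to \<open>S\<close> leaves an odd remainder,
    so the difference stays the same while \<open>S\<close> grows.\<close>
  have odd: "odd (card C)" if C: "C \<in> P" for C
  proof (rule ccontr)
    assume even: "\<not> odd (card C)"
    obtain c where c: "c \<in> C" using ne[OF C] by auto
    then have oc: "odd (card (C - {c}))" using even card_Suc_Diff1[OF parts(2)[OF C] c] by (metis even_Suc)
    then have "C - {c} \<noteq> {}" by force
    then have "separated_partition E (C - {c} - {}) {C - {c}}" unfolding separated_partition_def by auto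
    note r = refine[OF C c _ this]
    have "{D \<in> P - {C}. odd (card D)} = {D \<in> P. odd (card D)}" using even by auto
    then have "odds (P - {C}) = odds P" unfolding odds_def by simp
    moreover have "{D \<in> {C - {c}}. odd (card D)} = {C - {c}}" using oc by auto
    then have "odds {C - {c}} = 1" unfolding odds_def by simp
    ultimately show False
      using r no_larger[of "insert c ({} \<union> S)" "(P - {C}) \<union> {C - {c}}"] by simp
  qed
  then have "{C \<in> P. odd (card C)} = P" by auto
  then have oddsP: "odds P = int (card P)" by (simp add: odds_def)
  have crit: "critical E C" if C: "C \<in> P" for C
    unfolding critical_def
  proof (intro conjI ballI ne[OF C])
    fix c assume c: "c \<in> C"
    let ?D = "C - {c}"
    show "matchable E ?D"
    proof (rule ccontr)
      assume nm: "\<not> matchable E ?D"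
      have finD: "finite ?D" using parts(2)[OF C] by auto
      have "card C \<le> card V" using parts(3)[OF C] fin by (intro card_mono) auto
      then have "card ?D < card V" using card_Diff1_less[OF parts(2)[OF C] c] by simp
      then obtain T Q where TQ: "barrier E ?D T Q" using less.hyps finD by blast
      have evD: "even (card ?D)" using odd[OF C] card_Suc_Diff1[OF parts(2)[OF C] c] by (metis even_Suc)
      \<comment> \<open>Moving \<open>c\<close> and \<open>T\<close> into \<open>S\<close> costs
        \<open>card T + 1\<close> and the odd part \<open>C\<close>, but gains at least
        \<open>card T + 2\<close> odd parts: the difference does not drop, and \<open>S\<close>
        grows.\<close>
      have two: "card T + 2 \<le> card Q" using barrier_deficiency[OF finD assms(2) TQ evD nm] .
      have "T \<subseteq> ?D" "separated_partition E (?D - T) Q" using TQ unfolding barrier_def by auto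
      note r = refine[OF C c this]
      have "{B \<in> Q. odd (card B)} = Q" using barrier_parts(4)[OF finD TQ] by auto
      then have "odds Q = int (card Q)" by (simp add: odds_def)
      moreover have "{B \<in> P - {C}. odd (card B)} = P - {C}" using odd by auto
      then have "odds (P - {C}) = int (card P) - 1"
        using card_Suc_Diff1[OF parts(1) C] by (simp add: odds_def)
      ultimately show False
        using r two oddsP no_larger[of "insert c (T \<union> S)" "(P - {C}) \<union> Q"] by simp
    qed
  qed
  have hall: "card B \<le> card (attached E P `` B)" if B: "B \<subseteq> S" for B
  proof (cases "B = {}")
    case False
    let ?Q = "attached E P `` B"
    \<comment> \<open>Merging \<open>B\<close> with its attached parts shrinks \<open>S\<close> by
      \<open>card B\<close> and loses at most as many odd parts as are attached. Maximality compares
      the two numbers.\<close>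
    let ?P = "insert (B \<union> \<Union>?Q) (P - ?Q)"
    have "separated_partition E (V - S \<union> B) ?P"
    proof (rule separated_partition_merge[OF sep])
      show "?Q \<subseteq> P" by (rule finite_attached(2)[OF parts(1)])
      show "B \<noteq> {}" "B \<inter> (V - S) = {}" using False B by auto
    next
      fix b C assume "b \<in> B" "C \<in> P - ?Q"
      then have "(b, c) \<notin> E" "(c, b) \<notin> E" if "c \<in> C" for c
        using that assms(2) unfolding attached_def by (auto dest: symD)
      then show "E \<inter> {b} \<times> C = {} \<and> E \<inter> C \<times> {b} = {}" by auto
    qed
    moreover have "V - S \<union> B = V - (S - B)" using B S by auto
    ultimately have "odds ?P - int (card (S - B)) \<le> odds P - int (card S)"
      using S by (intro deficit_le) auto
    moreover have "card (S - B) = card S - card B" "card B \<le> card S"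
      using B finS finite_subset by (auto intro: card_Diff_subset card_mono)
    ultimately have "odds ?P + int (card B) \<le> int (card P)" using oddsP by simp
    moreover have "card (P - ?Q) = card P - card ?Q" "card ?Q \<le> card P"
      using finite_attached[OF parts(1), of E B] parts(1) by (auto intro: card_Diff_subset card_mono)
    moreover have "card (P - ?Q) \<le> card {C \<in> ?P. odd (card C)}"
      using odd parts(1) by (intro card_mono) auto
    ultimately show ?thesis unfolding odds_def by simp
  qed simp
  show ?case
    using S sep crit hall unfolding barrier_def by blast
qed

subsection \<open>Cubic bipartite graphs\<close>

locale cubic_bipartite = regular_bipartite 3 X Y R
  for X :: "'a set" and Y :: "'b set" and R :: "('a \<times> 'b) set"
begin

abbreviation E :: "('a \<times> 'a) set" where
  "E \<equiv> R O R\<inverse>"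

text \<open>The value \<open>f x\<close> is the end of the only edge kept at \<open>x\<close>; a
  second vertex with the same value keeps degree 1 out of \<open>Y\<close>.\<close>

definition anti_factorable :: "'a set \<Rightarrow> bool" where
  "anti_factorable V \<longleftrightarrow> (\<exists>f. \<forall>x\<in>V. (x, f x) \<in> R \<and> (\<exists>x'\<in>V. x' \<noteq> x \<and> f x' = f x))"

text \<open>For \<open>C \<subseteq> X\<close> these are the edges leaving the set formed by
  \<open>C\<close> and its neighbours.\<close>

definition out :: "'a set \<Rightarrow> ('a \<times> 'b) set" where
  "out C = {(s, y) \<in> R. s \<notin> C \<and> y \<in> R `` C}"

lemma sym_E: "sym E"
  by (auto intro: symI)

lemma anti_factorable_empty: "anti_factorable {}"
  by (simp add: anti_factorable_def)

text \<open>Values shared by the two choices do no harm: a value taken twice in one set stays taken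
  at least twice.\<close>

lemma anti_factorable_Un:
  assumes "anti_factorable A" "anti_factorable B" "A \<inter> B = {}"
  shows "anti_factorable (A \<union> B)"
proof -
  obtain f where f: "\<And>x. x \<in> A \<Longrightarrow> (x, f x) \<in> R \<and> (\<exists>x'\<in>A. x' \<noteq> x \<and> f x' = f x)"
    using assms(1) unfolding anti_factorable_def by blast
  obtain g where g: "\<And>x. x \<in> B \<Longrightarrow> (x, g x) \<in> R \<and> (\<exists>x'\<in>B. x' \<noteq> x \<and> g x' = g x)"
    using assms(2) unfolding anti_factorable_def by blast
  define h where "h x = (if x \<in> A then f x else g x)" for x
  have h: "h x = f x" if "x \<in> A" for x using that by (simp add: h_def)
  have h': "h x = g x" if "x \<in> B" for x using that assms(3) by (auto simp: h_def)
  show ?thesis unfolding anti_factorable_def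
  proof (intro exI[of _ h] ballI)
    fix x assume "x \<in> A \<union> B"
    then show "(x, h x) \<in> R \<and> (\<exists>x'\<in>A \<union> B. x' \<noteq> x \<and> h x' = h x)"
    proof
      assume "x \<in> A"
      then show ?thesis using f[of x] h by (metis UnI1)
    next
      assume "x \<in> B"
      then show ?thesis using g[of x] h' by (metis UnI2)
    qed
  qed
qed

lemma anti_factorable_star:
  assumes "T \<subseteq> R\<inverse> `` {y}" "a \<in> T" "b \<in> T" "a \<noteq> b"
  shows "anti_factorable T"
  unfolding anti_factorable_def
proof (intro exI[of _ "\<lambda>_. y"] ballI conjI)
  fix x assume "x \<in> T"
  then show "(x, y) \<in> R" using assms(1) by auto
  show "\<exists>x'\<in>T. x' \<noteq> x \<and> y = y" using assms(2-4) by metis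
qed

lemma matchable_anti_factorable:
  assumes "matchable E V"
  shows "anti_factorable V"
proof -
  obtain m where m: "\<And>x. x \<in> V \<Longrightarrow> m x \<in> V \<and> m x \<noteq> x \<and> m (m x) = x \<and> (x, m x) \<in> E"
    using assms unfolding matchable_def by blast
  \<comment> \<open>The set of common neighbours is the same for \<open>x\<close> and
    \<open>m x\<close>, so \<open>SOME\<close> returns one value for both.\<close>
  define f where "f x = (SOME y. y \<in> R `` {x} \<inter> R `` {m x})" for x
  have f: "(x, f x) \<in> R \<and> f (m x) = f x" if "x \<in> V" for x
  proof
    have "R `` {x} \<inter> R `` {m x} \<noteq> {}" using m[OF that] by auto
    then have "f x \<in> R `` {x} \<inter> R `` {m x}" unfolding f_def some_in_eq .
    then show "(x, f x) \<in> R" by auto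
    show "f (m x) = f x" using m[OF that] by (simp add: f_def Int_commute)
  qed
  show ?thesis unfolding anti_factorable_def
    using f m by (intro exI[of _ f]) metis
qed

section \<open>Counting outgoing edges\<close>

text \<open>Every edge at a neighbour of \<open>C\<close> either starts in \<open>C\<close>, which
  gives \<open>3 * card C\<close> edges, or belongs to \<open>out C\<close>.\<close>

lemma card_out:
  assumes "C \<subseteq> X"
  shows "card (out C) + 3 * card C = 3 * card (R `` C)"
proof -
  interpret c: regular_bipartite 3 Y X "R\<inverse>" by (rule converse)
  let ?I = "SIGMA x:C. R `` {x}"
  have I: "?I \<subseteq> R" by auto
  have "R `` C \<subseteq> Y" using R_sub by auto
  then have "3 * card (R `` C) = card (SIGMA y:R `` C. R\<inverse> `` {y})" using c.card_edges by simp
  also have "\<dots> = card (prod.swap ` (SIGMA y:R `` C. R\<inverse> `` {y}))" by (simp add: card_image)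
  also have "prod.swap ` (SIGMA y:R `` C. R\<inverse> `` {y}) = out C \<union> ?I"
    unfolding out_def by (auto simp: image_iff)
  also have "card \<dots> = card (out C) + card ?I"
    using finite_R finite_subset[OF I] by (intro card_Un_disjoint) (auto simp: out_def intro: finite_subset[of _ R])
  also have "card ?I = 3 * card C" using card_edges[OF assms] .
  finally show ?thesis by simp
qed

text \<open>Used to raise a nonzero count to at least 3 and a count above 3 to at least 6.\<close>

lemma out_dvd:
  assumes "C \<subseteq> X"
  shows "3 dvd card (out C)"
  using card_out[OF assms] by presburger

lemma finite_out: "finite (out C)"
  unfolding out_def using finite_R by (auto intro: finite_subset[of _ R])

lemma nbs_disjoint:
  assumes "separated_partition E V P" "C \<in> P" "D \<in> P" "y \<in> R `` C" "y \<in> R `` D"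
  shows "C = D"
proof (rule ccontr)
  assume "C \<noteq> D"
  then have "E \<inter> C \<times> D = {}" using assms unfolding separated_partition_def by simp
  moreover obtain c d where "(c, y) \<in> R" "c \<in> C" "(d, y) \<in> R" "d \<in> D" using assms(4,5) by auto
  ultimately show False by blast
qed

text \<open>A start in another part is excluded by \<open>nbs_disjoint\<close>; with a start outside
  \<open>K\<close> the edge also belongs to \<open>out K\<close>.\<close>

lemma out_part:
  assumes "separated_partition E (K - S) P" "C \<in> P" "K \<subseteq> X" "(s, y) \<in> out C"
  shows "(s, y) \<in> R" "s \<in> S \<or> (s, y) \<in> out K"
proof -
  have CK: "C \<subseteq> K" using assms(1,2) unfolding separated_partition_def by auto
  have sy: "(s, y) \<in> R" "s \<notin> C" "y \<in> R `` C" using assms(4) unfolding out_def by auto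
  show "(s, y) \<in> R" by fact
  show "s \<in> S \<or> (s, y) \<in> out K"
  proof (cases "s \<in> K - S")
    case True
    then have "s \<in> \<Union>P" using assms(1) unfolding separated_partition_def by auto
    then obtain D where D: "D \<in> P" "s \<in> D" by auto
    then have "y \<in> R `` D" using sy by auto
    then show ?thesis using nbs_disjoint[OF assms(1,2) D(1) sy(3)] D sy by simp
  next
    case False
    then show ?thesis using sy CK unfolding out_def by auto
  qed
qed

lemma sum_card_out:
  assumes "separated_partition E V P" "Q \<subseteq> P" "finite V"
  shows "(\<Sum>C\<in>Q. card (out C)) = card (\<Union>C\<in>Q. out C)"
proof (rule card_UN_disjoint[symmetric])
  show "finite Q" using separated_partition_finite(1)[OF assms(3,1)] assms(2) finite_subset by blast
  show "\<forall>C\<in>Q. finite (out C)" using finite_out by simp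
  show "\<forall>C\<in>Q. \<forall>D\<in>Q. C \<noteq> D \<longrightarrow> out C \<inter> out D = {}"
  proof (intro ballI impI)
    fix C D assume CD: "C \<in> Q" "D \<in> Q" "C \<noteq> D"
    then have "C \<in> P" "D \<in> P" using assms(2) by auto
    then have "y \<notin> R `` C \<or> y \<notin> R `` D" for y using nbs_disjoint[OF assms(1)] CD(3) by blast
    then show "out C \<inter> out D = {}" unfolding out_def by blast
  qed
qed

text \<open>Otherwise every neighbour of \<open>K\<close> carries an outgoing edge, so
  \<open>K\<close> has at most three neighbours; \<open>card_out\<close> and parity leave only a
  single vertex, which has six outgoing edges.\<close>

lemma contains_star:
  assumes "K \<subseteq> X" "odd (card K)" "card (out K) \<le> 3"
  shows "\<exists>y\<in>Y. R\<inverse> `` {y} \<subseteq> K"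
proof (rule ccontr)
  assume contr: "\<not> ?thesis"
  have "R `` K \<subseteq> snd ` out K"
  proof
    fix y assume y: "y \<in> R `` K"
    then have "y \<in> Y" using R_sub by auto
    then obtain s where "(s, y) \<in> R" "s \<notin> K" using contr by auto
    then have "(s, y) \<in> out K" using y unfolding out_def by simp
    then show "y \<in> snd ` out K" by (rule image_eqI[rotated]) simp
  qed
  then have "card (R `` K) \<le> card (snd ` out K)" by (intro card_mono finite_imageI finite_out)
  also have "\<dots> \<le> card (out K)" by (rule card_image_le[OF finite_out])
  finally have le: "card (R `` K) \<le> card (out K)" .
  have "card K > 0" using assms(2) by (simp add: odd_pos)
  then have "card K = 1" using le card_out[OF assms(1)] assms(2,3) by presburger
  then obtain x where "K = {x}" by (auto simp: card_1_singleton_iff)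
  then have "card (R `` K) = 3" "card (out K) = 6"
    using card_nbs[of x] card_out[OF assms(1)] assms(1) by auto
  then show False using assms(3) by simp
qed

text \<open>The bound on \<open>out K\<close> is used twice: it provides a star inside
  \<open>K\<close>, and it leaves room for at most one part with more than three outgoing
  edges.\<close>

lemma critical_anti_factorable:
  assumes "K \<subseteq> X" "critical E K" "card (out K) \<le> 3"
  shows "anti_factorable K"
  using assms
proof (induction "card K" arbitrary: K rule: less_induct)
  case less
  note KX = less.prems(1) and crit = less.prems(2) and outK = less.prems(3)
  have finK: "finite K" using KX finite_X finite_subset by blast
  have oddK: "odd (card K)" using critical_odd[OF finK crit] .
  obtain y0 where y0: "y0 \<in> Y" "R\<inverse> `` {y0} \<subseteq> K" using contains_star[OF KX oddK outK] by auto
  define T where "T = R\<inverse> `` {y0}"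
  have T: "T \<subseteq> K" "card T = 3" using y0 card_nbs'[of y0] by (auto simp: T_def)
  obtain v a b where vab: "T = {v, a, b}" "v \<noteq> a" "v \<noteq> b" "a \<noteq> b"
    using T(2) by (metis card_3_iff)
  show ?case
  proof (cases "matchable E (K - T)")
    case True
    have "anti_factorable T" using vab by (intro anti_factorable_star[of T y0 v a]) (auto simp: T_def)
    then have "anti_factorable (T \<union> (K - T))"
      by (rule anti_factorable_Un[OF _ matchable_anti_factorable[OF True]]) auto
    moreover have "T \<union> (K - T) = K" using T by auto
    ultimately show ?thesis by simp
  next
    case False
    have finKT: "finite (K - T)" using finK by simp
    obtain S' P where bar: "barrier E (K - T) S' P" using barrier_exists[OF finKT sym_E] by auto
    have finT: "finite T" using T finK finite_subset by blast
    have "card (K - T) = card K - 3" "3 \<le> card K"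
      using T finK finT by (auto simp: card_Diff_subset dest: card_mono[OF finK])
    then have "even (card (K - T))" using oddK by simp
    then have defi: "card S' + 2 \<le> card P" using barrier_deficiency[OF finKT sym_E bar] False by simp
    \<comment> \<open>The parts stay the same, and the deficiency bound becomes
      \<open>card S \<le> card P + 1\<close>.\<close>
    define S where "S = S' \<union> T"
    have S': "S' \<subseteq> K - T" using bar unfolding barrier_def by simp
    then have finS': "finite S'" using finKT finite_subset by blast
    have "S' \<inter> T = {}" using S' by auto
    then have cardS: "card S = card S' + 3" using T(2) finS' finT by (simp add: S_def card_Un_disjoint)
    have SK: "S \<subseteq> K" and TS: "T \<subseteq> S" and finS: "finite S" using S' T finS' finT by (auto simp: S_def)
    have "K - T - S' = K - S" by (auto simp: S_def)
    then have sep: "separated_partition E (K - S) P" using bar unfolding barrier_def by simp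
    have critP: "critical E C" if "C \<in> P" for C using bar that unfolding barrier_def by simp
    note parts = barrier_parts[OF finKT bar]
    have CKS: "C \<subseteq> K - S" if "C \<in> P" for C using that sep unfolding separated_partition_def by auto
    have "v \<in> K" using vab T by auto
    then obtain m where m: "\<And>x. x \<in> K - {v} \<Longrightarrow> m x \<in> K - {v} \<and> m x \<noteq> x \<and> m (m x) = x \<and> (x, m x) \<in> E"
      using crit unfolding critical_def matchable_def by blast
    have vS: "v \<in> S" using vab TS by auto
    have same_part: "D = C" if "x \<in> D" "m x \<in> C" "C \<in> P" "D \<in> P" for x C D
    proof -
      have "x \<in> K - {v}" using CKS[OF that(4)] that(1) vS by auto
      then have "(x, m x) \<in> E" using m by blast
      then show ?thesis using sep that unfolding separated_partition_def by blast
    qed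
    \<comment> \<open>A part has odd size, so \<open>m\<close> cannot match it within itself. As
      \<open>m\<close> never joins different parts, some partner lies in \<open>S\<close>.\<close>
    have leaves: "\<exists>x\<in>C. m x \<notin> C" if C: "C \<in> P" for C
    proof (rule ccontr)
      assume "\<not> ?thesis"
      moreover have "C \<subseteq> K - {v}" using CKS[OF C] vS by auto
      ultimately have "matchable E C" unfolding matchable_def using m by (intro exI[of _ m]) blast
      then show False using matchable_even[OF parts(2)[OF C]] parts(4)[OF C] by simp
    qed
    have "\<exists>s\<in>S - {v}. m s \<in> C" if C: "C \<in> P" for C
    proof -
      obtain x where x: "x \<in> C" "m x \<notin> C" using leaves[OF C] by auto
      then have xK: "x \<in> K - {v}" using CKS[OF C] vS by auto
      have "m x \<in> S"
      proof (rule ccontr)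
        assume "m x \<notin> S"
        then have "m x \<in> \<Union>P" using m[OF xK] sep unfolding separated_partition_def by auto
        then obtain D where "D \<in> P" "m x \<in> D" by auto
        then show False using same_part[OF x(1) _ _ C] x(2) by auto
      qed
      then show ?thesis using m[OF xK] x(1) by (intro bexI[of _ "m x"]) auto
    qed
    \<comment> \<open>The vertex \<open>e C\<close> of \<open>S - {v}\<close> has its partner in
      \<open>C\<close>. As parts are disjoint, \<open>e\<close> is injective, and the deficiency
      bound makes it a bijection.\<close>
    then obtain e where e: "\<And>C. C \<in> P \<Longrightarrow> e C \<in> S - {v} \<and> m (e C) \<in> C" by metis
    have inj_e: "inj_on e P"
    proof (rule inj_onI)
      fix C D assume CD: "C \<in> P" "D \<in> P" "e C = e D"
      then have "m (e C) \<in> C \<inter> D" using e by (metis IntI)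
      then show "C = D" using sep CD unfolding separated_partition_def by auto
    qed
    have "card (e ` P) \<le> card (S - {v})" using e finS by (intro card_mono) auto
    then have card_eP: "card P = card (S - {v})" "card (S - {v}) = card S' + 2"
      using defi vS cardS finS inj_e by (auto simp: card_image)
    then have eP: "e ` P = S - {v}"
      using e finS inj_e by (intro card_subset_eq) (auto simp: card_image)
    \<comment> \<open>A matching edge leaving \<open>C\<close> passes through a common neighbour and
      so yields an outgoing edge; divisibility by 3 does the rest.\<close>
    have out_ge: "3 \<le> card (out C)" if C: "C \<in> P" for C
    proof -
      obtain x where x: "x \<in> C" "m x \<notin> C" using leaves[OF C] by auto
      then have "x \<in> K - {v}" using CKS[OF C] vS by auto
      then have "(x, m x) \<in> E" using m by blast
      then obtain y where "(x, y) \<in> R" "(m x, y) \<in> R" by auto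
      then have "(m x, y) \<in> out C" using x unfolding out_def by auto
      then have "card (out C) \<noteq> 0" using finite_out by (auto simp: card_eq_0_iff)
      then show ?thesis using out_dvd[of C] CKS[OF C] KX by (auto dest: dvd_imp_le)
    qed
    \<comment> \<open>All neighbours of \<open>y0\<close> lie in \<open>T\<close>, hence in
      \<open>S\<close>, so no part has \<open>y0\<close> as a neighbour and three edges at
      \<open>S\<close> are saved.\<close>
    have "(\<Union>C\<in>P. out C) \<subseteq> ((SIGMA s:S. R `` {s}) - T \<times> {y0}) \<union> out K"
    proof clarify
      fix C s y assume C: "C \<in> P" and sy: "(s, y) \<in> out C" "(s, y) \<notin> out K"
      have "s \<in> S" "(s, y) \<in> R" using out_part[OF sep C KX sy(1)] sy(2) by auto
      moreover have "y \<noteq> y0"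
      proof
        assume "y = y0"
        then obtain c where "c \<in> C" "c \<in> T" using sy(1) unfolding out_def T_def by auto
        then show False using CKS[OF C] TS by auto
      qed
      ultimately show "(s, y) \<in> (SIGMA s:S. R `` {s}) - T \<times> {y0}" by auto
    qed
    then have "card (\<Union>C\<in>P. out C) \<le> card (((SIGMA s:S. R `` {s}) - T \<times> {y0}) \<union> out K)"
      using finS finite_R finite_out by (intro card_mono) (auto intro!: finite_SigmaI finite_Image)
    also have "\<dots> \<le> card ((SIGMA s:S. R `` {s}) - T \<times> {y0}) + card (out K)" by (rule card_Un_le)
    also have "card ((SIGMA s:S. R `` {s}) - T \<times> {y0}) = card (SIGMA s:S. R `` {s}) - card (T \<times> {y0})"
      using TS finT by (intro card_Diff_subset) (auto simp: T_def)
    also have "\<dots> = 3 * card S - 3"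
      using card_edges[of S] SK KX T by (auto simp: card_cartesian_product)
    finally have "(\<Sum>C\<in>P. card (out C)) \<le> 3 * card S - 3 + card (out K)"
      using sum_card_out[OF sep subset_refl] finK by simp
    then have sum_le: "(\<Sum>C\<in>P. card (out C)) \<le> 3 * card P + 3"
      using outK cardS card_eP by simp
    have "a \<in> e ` P" "b \<in> e ` P" unfolding eP using vab TS by auto
    then obtain A B where A: "A \<in> P" "e A = a" and B: "B \<in> P" "e B = b" by auto
    have AB: "A \<noteq> B" using A B vab by auto
    \<comment> \<open>With more than three outgoing edges at both \<open>A\<close> and
      \<open>B\<close>, the excess over \<open>3 * card P\<close> would be at least 6, but it is at
      most 3.\<close>
    have "\<exists>C\<in>P. e C \<in> {a, b} \<and> card (out C) \<le> 3"
    proof (rule ccontr)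
      assume "\<not> ?thesis"
      then have "3 < card (out A)" "3 < card (out B)" using A B by auto
      moreover have "3 dvd card (out A)" "3 dvd card (out B)"
        using out_dvd CKS[OF A(1)] CKS[OF B(1)] KX by blast+
      ultimately have "6 \<le> card (out A)" "6 \<le> card (out B)" by presburger+
      moreover have "(\<Sum>C\<in>P. card (out C)) = card (out A) + (card (out B) + (\<Sum>C\<in>P - {A} - {B}. card (out C)))"
        using A B AB parts(1) by (simp add: sum.remove[of P A] sum.remove[of "P - {A}" B])
      moreover have "3 * card (P - {A} - {B}) \<le> (\<Sum>C\<in>P - {A} - {B}. card (out C))"
        using sum_mono[of "P - {A} - {B}" "\<lambda>_. 3" "\<lambda>C. card (out C)"] out_ge by simp
      moreover have "card P = card (P - {A} - {B}) + 2"
        using A B AB parts(1) card.remove[of P A] card.remove[of "P - {A}" B] by simp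
      ultimately show False using sum_le by simp
    qed
    then obtain C where C: "C \<in> P" "e C \<in> {a, b}" "card (out C) \<le> 3" by auto
    have CK: "C \<subseteq> K - S" using CKS[OF C(1)] .
    have "anti_factorable C"
    proof (rule less.hyps)
      show "card C < card K" using CK vS SK finK by (intro psubset_card_mono) auto
      show "C \<subseteq> X" "critical E C" "card (out C) \<le> 3" using CK KX critP C by auto
    qed
    moreover have "anti_factorable {v, e C}"
    proof (rule anti_factorable_star)
      show "{v, e C} \<subseteq> R\<inverse> `` {y0}" using vab C(2) unfolding T_def by auto
      show "v \<noteq> e C" using e[OF C(1)] by auto
    qed auto
    moreover have "anti_factorable (K - {v, e C} - C)"
    proof (rule matchable_anti_factorable)
      \<comment> \<open>Apart from \<open>e C\<close>, no vertex of \<open>K - {v}\<close> outside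
        \<open>C\<close> has its partner in \<open>C\<close>: vertices of \<open>S - {v}\<close> are
        matched into their own parts, and different parts are not joined. So \<open>m\<close>
        preserves the remainder.\<close>
      show "matchable E (K - {v, e C} - C)" unfolding matchable_def
      proof (intro exI[of _ m] ballI)
        fix x assume x: "x \<in> K - {v, e C} - C"
        then have mx: "m x \<in> K - {v} \<and> m x \<noteq> x \<and> m (m x) = x \<and> (x, m x) \<in> E" using m by blast
        have "m x \<noteq> e C" using e[OF C(1)] mx x by auto
        moreover have "m x \<notin> C"
        proof
          assume mC: "m x \<in> C"
          show False
          proof (cases "x \<in> S")
            case True
            then have "x \<in> e ` P" unfolding eP using x by auto
            then obtain D where D: "D \<in> P" "x = e D" by auto
            then have "m x \<in> C \<inter> D" using e[OF D(1)] mC by auto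
            then have "D = C" using sep C(1) D(1) unfolding separated_partition_def by auto
            then show False using D x by auto
          next
            case False
            then have "x \<in> \<Union>P" using x sep unfolding separated_partition_def by auto
            then obtain D where "D \<in> P" "x \<in> D" by auto
            then show False using same_part[OF _ mC C(1)] x by auto
          qed
        qed
        ultimately show "m x \<in> K - {v, e C} - C \<and> m x \<noteq> x \<and> m (m x) = x \<and> (x, m x) \<in> E"
          using mx by auto
      qed
    qed
    ultimately have "anti_factorable ((C \<union> {v, e C}) \<union> (K - {v, e C} - C))"
      using CK vS e[OF C(1)] by (intro anti_factorable_Un) auto
    moreover have "(C \<union> {v, e C}) \<union> (K - {v, e C} - C) = K"
      using CK vS SK e[OF C(1)] by auto
    ultimately show ?thesis by simp
  qed
qed

lemma anti_factorable_X: "anti_factorable X"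
proof -
  obtain S P where bar: "barrier E X S P" using barrier_exists[OF finite_X sym_E] by auto
  note parts = barrier_parts[OF finite_X bar]
  have S: "S \<subseteq> X" and sep: "separated_partition E (X - S) P" and crit: "\<And>C. C \<in> P \<Longrightarrow> critical E C"
    using bar unfolding barrier_def by auto
  \<comment> \<open>These parts cannot be left alone and must be matched into
    \<open>S\<close>.\<close>
  define W where "W = {C \<in> P. \<not> anti_factorable C}"
  have out_ge: "3 \<le> card (out C)" if "C \<in> W" for C
  proof -
    have C: "C \<in> P" "\<not> anti_factorable C" using that by (auto simp: W_def)
    then have "\<not> card (out C) \<le> 3"
      using critical_anti_factorable[of C] parts(3)[OF C(1)] crit[OF C(1)] by auto
    then show ?thesis by simp
  qed
  have outX: "out X = {}" using R_sub by (auto simp: out_def)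
  have "\<exists>h. inj_on h S \<and> h ` S \<subseteq> P \<and> W \<subseteq> h ` S \<and> matchable E (\<Union>s\<in>S. insert s (h s))"
  proof (rule barrier_cover[OF finite_X sym_E bar])
    show "W \<subseteq> P" by (auto simp: W_def)
  next
    fix D assume D: "D \<subseteq> W"
    then have DP: "D \<subseteq> P" by (auto simp: W_def)
    let ?N = "{s \<in> S. \<exists>C\<in>D. (s, C) \<in> attached E P}"
    \<comment> \<open>Since \<open>out X\<close> is empty, all outgoing edges of the parts in
      \<open>D\<close> start at vertices of \<open>S\<close> attached to \<open>D\<close>, and each
      of these carries three edges.\<close>
    have "3 * card D \<le> (\<Sum>C\<in>D. card (out C))"
      using sum_mono[of D "\<lambda>_. 3" "\<lambda>C. card (out C)"] out_ge[OF subsetD[OF D]] by simp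
    also have "\<dots> = card (\<Union>C\<in>D. out C)" using finite_X by (intro sum_card_out[OF sep DP]) simp
    also have "\<dots> \<le> card (SIGMA s:?N. R `` {s})"
    proof (rule card_mono)
      have "finite S" using S finite_X finite_subset by blast
      then have "finite ?N" by simp
      then show "finite (SIGMA s:?N. R `` {s})" using finite_R by (auto intro!: finite_Image)
      show "(\<Union>C\<in>D. out C) \<subseteq> (SIGMA s:?N. R `` {s})"
      proof clarify
        fix C s y assume C: "C \<in> D" and sy: "(s, y) \<in> out C"
        have CP: "C \<in> P" using C DP by auto
        have "s \<in> S" "(s, y) \<in> R" using out_part[OF sep CP subset_refl sy] outX by auto
        moreover obtain c where "c \<in> C" "(c, y) \<in> R" using sy unfolding out_def by auto
        ultimately show "s \<in> ?N \<and> y \<in> R `` {s}" using C CP unfolding attached_def by auto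
      qed
    qed
    also have "\<dots> = 3 * card ?N" using S by (intro card_edges) auto
    finally show "card D \<le> card ?N" by simp
  qed
  then obtain h where h: "h ` S \<subseteq> P" "W \<subseteq> h ` S" "matchable E (\<Union>s\<in>S. insert s (h s))"
    by auto
  have "anti_factorable (\<Union>C\<in>P - h ` S. C)"
  proof (rule disjoint_family_Union[where P = anti_factorable])
    show "finite (P - h ` S)" using parts(1) by simp
    show "anti_factorable C" if "C \<in> P - h ` S" for C using that h(2) by (auto simp: W_def)
    show "C \<inter> D = {}" if "C \<in> P - h ` S" "D \<in> P - h ` S" "C \<noteq> D" for C D
      using that sep unfolding separated_partition_def by auto
  qed (auto intro: anti_factorable_empty anti_factorable_Un)
  moreover have "(\<Union>s\<in>S. insert s (h s)) \<inter> (\<Union>C\<in>P - h ` S. C) = {}"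
  proof -
    have "insert s (h s) \<inter> C = {}" if "s \<in> S" "C \<in> P - h ` S" for s C
    proof -
      have "h s \<in> P" "h s \<noteq> C" using that h(1) by auto
      then have "h s \<inter> C = {}" using that sep unfolding separated_partition_def by simp
      moreover have "s \<notin> C" using that parts(3) by auto
      ultimately show ?thesis by auto
    qed
    then show ?thesis by blast
  qed
  ultimately have "anti_factorable ((\<Union>s\<in>S. insert s (h s)) \<union> (\<Union>C\<in>P - h ` S. C))"
    by (intro anti_factorable_Un[OF matchable_anti_factorable[OF h(3)]])
  moreover have "(\<Union>s\<in>S. insert s (h s)) \<union> (\<Union>C\<in>P - h ` S. C) = S \<union> \<Union>P"
    using h(1) by auto
  moreover have "S \<union> \<Union>P = X" using sep S unfolding separated_partition_def by auto
  ultimately show ?thesis by simp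
qed

end

section \<open>Translation between symmetric digraphs and relations\<close>

theorem theorem1p4:
  fixes k :: nat and G :: "('a, 'b) pre_digraph" and X Y :: "'a set"
  assumes "k \<ge> 3"
    and "regular_graph k G"
    and "bipartition G X Y"
  shows "\<exists>F. one_anti_factor F G X Y"
proof -
  interpret G: graph G using assms(2) unfolding regular_graph_def by simp
  have deg: "card (out_arcs G v) = k" if "v \<in> verts G" for v
    using assms(2) that unfolding regular_graph_def degree_def out_degree_def by simp
  have XY: "X \<union> Y = verts G" "X \<inter> Y = {}"
    and ends: "\<And>e. e \<in> arcs G \<Longrightarrow> tail G e \<in> X \<and> head G e \<in> Y \<or> tail G e \<in> Y \<and> head G e \<in> X"
    using assms(3) unfolding bipartition_def by auto
  have flip: "\<exists>e'\<in>arcs G. tail G e' = head G e \<and> head G e' = tail G e" if "e \<in> arcs G" for e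
    using G.sym_arcs that unfolding symmetric_conv by metis
  have nomulti: "e = e'" if "e \<in> arcs G" "e' \<in> arcs G" "tail G e = tail G e'" "head G e = head G e'" for e e'
    using G.no_multi_arcs that unfolding arc_to_ends_def by simp
  \<comment> \<open>Of the two arcs of each edge, only the one from \<open>X\<close> to
    \<open>Y\<close> is recorded.\<close>
  define R where "R = {(tail G e, head G e) | e. e \<in> arcs G \<and> tail G e \<in> X}"
  have card_heads: "card (head G ` out_arcs G v) = k" if "v \<in> verts G" for v
    using deg[OF that] nomulti by (subst card_image) (auto intro!: inj_onI)
  have regular: "regular_bipartite k X Y R"
  proof
    show "finite X" "finite Y" using XY(1) G.finite_verts by (metis finite_Un)+
    show "R \<subseteq> X \<times> Y" using ends XY(2) by (auto simp: R_def)
  next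
    fix x assume x: "x \<in> X"
    then have "R `` {x} = head G ` out_arcs G x" by (auto simp: R_def)
    then show "card (R `` {x}) = k" using card_heads x XY(1) by auto
  next
    fix y assume y: "y \<in> Y"
    have "R\<inverse> `` {y} = head G ` out_arcs G y"
    proof (intro equalityI subsetI)
      fix x assume "x \<in> R\<inverse> `` {y}"
      then obtain e where "e \<in> arcs G" "tail G e = x" "head G e = y" by (auto simp: R_def)
      then obtain e' where "e' \<in> arcs G" "tail G e' = y" "head G e' = x" using flip by metis
      then show "x \<in> head G ` out_arcs G y" by auto
    next
      fix x assume "x \<in> head G ` out_arcs G y"
      then obtain e where e: "e \<in> arcs G" "tail G e = y" "head G e = x" by auto
      then obtain e' where e': "e' \<in> arcs G" "tail G e' = x" "head G e' = y" using flip by metis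
      have "x \<in> X" using ends[OF e(1)] e y XY(2) by auto
      then show "x \<in> R\<inverse> `` {y}" using e' by (auto simp: R_def)
    qed
    then show "card (R\<inverse> `` {y}) = k" using card_heads y XY(1) by auto
  qed
  obtain T where T: "T \<subseteq> R" "regular_bipartite 3 X Y T"
    using regular_bipartite_3[OF assms(1) regular] by auto
  interpret cubic_bipartite X Y T using T(2) unfolding cubic_bipartite_def .
  obtain f where f: "\<And>x. x \<in> X \<Longrightarrow> (x, f x) \<in> T"
    and f': "\<And>x. x \<in> X \<Longrightarrow> \<exists>x'\<in>X. x' \<noteq> x \<and> f x' = f x"
    using anti_factorable_X unfolding anti_factorable_def by blast
  have arc: "\<exists>e\<in>arcs G. tail G e = x \<and> head G e = f x" if "x \<in> X" for x
  proof -
    have "(x, f x) \<in> R" using f[OF that] T(1) by auto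
    then show ?thesis by (auto simp: R_def)
  qed
  \<comment> \<open>The second alternative adds the reverse of each chosen arc and so makes
    \<open>F\<close> symmetric.\<close>
  define A where "A = {e \<in> arcs G. tail G e \<in> X \<and> head G e = f (tail G e) \<or>
    head G e \<in> X \<and> tail G e = f (head G e)}"
  define F where "F = G\<lparr>arcs := A\<rparr>"
  have F: "verts F = verts G" "arcs F = A" "tail F = tail G" "head F = head G"
    by (simp_all add: F_def)
  have AG: "A \<subseteq> arcs G" by (auto simp: A_def)
  have sym_F: "symmetric F" unfolding symmetric_conv F
  proof
    fix e assume e: "e \<in> A"
    then obtain e' where e': "e' \<in> arcs G" "tail G e' = head G e" "head G e' = tail G e"
      using flip AG by blast
    then have "e' \<in> A" using e unfolding A_def by auto
    then show "\<exists>e'\<in>A. tail G e = head G e' \<and> head G e = tail G e'" using e' by metis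
  qed
  have graph_F: "graph F"
  proof unfold_locales
    show "symmetric F" by (fact sym_F)
    show "finite (arcs F)" unfolding F using finite_subset[OF AG G.finite_arcs] .
  next
    fix e assume "e \<in> arcs F"
    then have "e \<in> arcs G" using AG by (auto simp: F)
    then show "tail F e \<in> verts F" "head F e \<in> verts F" "tail F e \<noteq> head F e"
      using G.no_loops by (simp_all add: F)
  next
    fix e e' assume "e \<in> arcs F" "e' \<in> arcs F" "arc_to_ends F e = arc_to_ends F e'"
    then show "e = e'" using AG by (intro nomulti) (auto simp: F arc_to_ends_def)
  qed (simp add: F)
  moreover have "spanning F G"
    unfolding spanning_def subgraph_def compatible_def
    using AG G.wf_digraph_axioms graph.axioms(1)[OF graph_F]
    by (simp add: F digraph_def fin_digraph_def)
  moreover have "degree F x = 1" if x: "x \<in> X" for x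
  proof -
    obtain e where e: "e \<in> arcs G" "tail G e = x" "head G e = f x" using arc[OF x] by auto
    have "out_arcs F x = {e}"
    proof (intro equalityI subsetI)
      fix e' assume "e' \<in> out_arcs F x"
      then have e': "e' \<in> A" "tail G e' = x" by (auto simp: F)
      then have "head G e' \<notin> X" using ends[of e'] AG x XY(2) by auto
      then have "head G e' = f x" using e' by (auto simp: A_def)
      then show "e' \<in> {e}" using nomulti[of e' e] e e' AG by auto
    next
      fix e' assume "e' \<in> {e}"
      then show "e' \<in> out_arcs F x" using e x by (auto simp: F A_def)
    qed
    then show ?thesis unfolding degree_def out_degree_def by simp
  qed
  moreover have "degree F y \<noteq> 1" if y: "y \<in> Y" for y
  proof
    assume "degree F y = 1"
    then obtain e where e: "out_arcs F y = {e}"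
      unfolding degree_def out_degree_def by (auto simp: card_1_singleton_iff)
    then have "e \<in> A" "tail G e = y" by (auto simp: F out_arcs_def)
    \<comment> \<open>A lone arc at \<open>y\<close> leads to a vertex that chose \<open>y\<close>.
      A second vertex of \<open>X\<close> chose \<open>y\<close> too, and its edge gives another arc
      leaving \<open>y\<close>.\<close>
    then have x: "head G e \<in> X" "f (head G e) = y" using y XY(2) by (auto simp: A_def)
    then obtain x' where x': "x' \<in> X" "x' \<noteq> head G e" "f x' = y" using f' by metis
    then obtain e' where "e' \<in> arcs G" "tail G e' = y" "head G e' = x'" using arc flip by metis
    then have "e' \<in> out_arcs F y" using x' by (auto simp: F A_def)
    then show False using e x' \<open>head G e' = x'\<close> by simp
  qed
  ultimately show ?thesis
    unfolding one_anti_factor_def spanning_subgraph_def by blast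
qed

end
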